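(* Let \[ M=\operatorname{diag}(e^{\mathrm{i}\mu_1},\ldots,e^{\mathrm{i}\mu_n}),\qquad \pi>\mu_1\ge\cdots\ge\mu_n>-\pi/2,\qquad \mu_1-\mu_n<\pi, \] and let $\Delta\in\mathbb{R}^{n\times n}$ satisfy $\Delta+\Delta^T\succ0$ and $\det(I+M\Delta)=0$. Choose $z\in\mathbb{C}^n$, $z\ne0$, such that $\Delta z=-M^{-1}z$, and define \[ p_j:=\frac{|z_j|^2}{\|z\|^2},\qquad q:=-\sum_{j=1}^n p_j\cos\mu_j,\qquad r:=\sum_{j=1}^n p_j\sin\mu_j,\qquad \rho:=\max\{0,\,2\max_j p_j-1\}. \] Then $q>\rho$ and \[ \phi_1(\Delta)\ge\arctan\frac{|r|}{\sqrt{q^2-\rho^2}} . \]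
   Context: $\succ0$ means positive definite, and $\|\cdot\|$ is the Euclidean norm. A real matrix $\Delta\in\mathbb{R}^{n\times n}$ with $\Delta+\Delta^T\succ0$ can be written as $\Delta=T^*\operatorname{diag}(e^{\mathrm{i}\phi_1(\Delta)},\ldots,e^{\mathrm{i}\phi_n(\Delta)})T$ with $T\in\mathbb{C}^{n\times n}$ invertible and uniquely determined numbers (the *phases* of $\Delta$) $\pi/2>\phi_1(\Delta)\ge\cdots\ge\phi_n(\Delta)>-\pi/2$; the largest phase satisfies $\phi_1(\Delta)=\max_{x\in\mathbb{C}^n,\|x\|=1}\angle(x^*\Delta x)$, with $\angle$ the argument in $(-\pi/2,\pi/2)$. *)

theory Defs
  imports "HOL-Analysis.Analysis"
begin

text \<open>
  The index set \<open>{1, \<dots>, n}\<close> is rendered as an arbitrary type \<open>'n :: {finite, linorder}\<close>, so that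
  \<open>n = CARD('n) \<ge> 1\<close>. The linear order gives a meaning to "nonincreasing" families; the indices
  \<open>1\<close> and \<open>n\<close> are the following two elements.
\<close>

definition first_index :: "'n :: {finite, linorder}" where
  "first_index = Min UNIV"

definition last_index :: "'n :: {finite, linorder}" where
  "last_index = Max UNIV"

text \<open>
  Square matrices indexed by \<open>'n\<close>, that is, \<open>'a ^ 'n ^ 'n\<close>; the infix notation would
  impose the sort \<open>finite\<close> on \<open>'n\<close>, which clashes with \<open>{finite, linorder}\<close>.
\<close>

type_synonym ('a, 'n) sq_matrix = "(('a, 'n) vec, 'n) vec"

definition positive_definite :: "real ^ 'n ^ 'n \<Rightarrow> bool" where
  "positive_definite A \<longleftrightarrow> transpose A = A \<and> (\<forall>x. x \<noteq> 0 \<longrightarrow> x \<bullet> (A *v x) > 0)"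

definition conj_transpose :: "complex ^ 'n ^ 'm \<Rightarrow> complex ^ 'm ^ 'n" where
  "conj_transpose A = (\<chi> i j. cnj (A $ j $ i))"

abbreviation complexify :: "real ^ 'n ^ 'm \<Rightarrow> complex ^ 'n ^ 'm" where
  "complexify A \<equiv> map_matrix complex_of_real A"

definition diag_cis :: "('n \<Rightarrow> real) \<Rightarrow> complex ^ 'n ^ 'n" where
  "diag_cis \<theta> = (\<chi> i j. if i = j then cis (\<theta> i) else 0)"

definition is_phases :: "(real, 'n) sq_matrix \<Rightarrow> ('n :: {finite, linorder} \<Rightarrow> real) \<Rightarrow> bool" where
  "is_phases \<Delta> \<phi> \<longleftrightarrow>
     antimono \<phi> \<and> (\<forall>i. - pi / 2 < \<phi> i \<and> \<phi> i < pi / 2) \<and>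
     (\<exists>T :: (complex, 'n) sq_matrix. invertible T \<and>
        complexify \<Delta> = conj_transpose T ** diag_cis \<phi> ** T)"

text \<open>
  Exactly one family \<open>\<phi>\<close> satisfies \<open>is_phases \<Delta> \<phi>\<close> whenever \<open>\<Delta> + transpose \<Delta>\<close> is positive
  definite; only for such \<open>\<Delta>\<close> is the value of \<open>phases \<Delta>\<close> meaningful.
\<close>

definition phases :: "(real, 'n) sq_matrix \<Rightarrow> 'n :: {finite, linorder} \<Rightarrow> real" where
  "phases \<Delta> = (THE \<phi>. is_phases \<Delta> \<phi>)"

end

theory Submission
  imports Defs
begin

text \<open>
  Normalize \<open>z\<close> to a unit vector \<open>y\<close>. Then \<open>y\<^sup>* \<Delta> y = q + i r\<close>, and since \<open>\<Delta>\<close> is real,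
  the conjugate vector has the conjugate value. On the plane spanned by \<open>y\<close> and its conjugate the
  form \<open>x\<^sup>* \<Delta> x\<close> is therefore determined by \<open>q\<close>, \<open>r\<close> and the off-diagonal entry
  \<open>c = y\<^sup>T \<Delta> y = - (\<Sum>j. cis (- \<mu> j) * (y $ j)\<^sup>2)\<close>. Positivity of the real part gives
  \<open>cmod c < q\<close>, the reverse triangle inequality gives \<open>\<rho> \<le> cmod c\<close>, and the largest angle on
  this plane is \<open>arctan (\<bar>r\<bar> / sqrt (q\<^sup>2 - (cmod c)\<^sup>2))\<close>, which the largest phase dominates.
  That the phases exist and are unique follows from the simultaneous diagonalization of the Hermitian
  and the skew-Hermitian part of \<open>\<Delta>\<close> and from a Courant--Fischer dimension count.
\<close>

section \<open>Sesquilinear forms\<close>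

text \<open>The number \<open>x^* A y\<close>, conjugate-linear in \<open>x\<close>. On complex
  vectors \<open>\<bullet>\<close> is the real inner product and would retain only its real part,
  hence the explicit sum.\<close>

definition cform :: "complex ^ 'n ^ 'n \<Rightarrow> complex ^ 'n \<Rightarrow> complex ^ 'n \<Rightarrow> complex" where
  "cform A x y = (\<Sum>i\<in>UNIV. cnj (x $ i) * (A *v y) $ i)"

lemma cform_add_left: "cform A (x + y) w = cform A x w + cform A y w"
  by (simp add: cform_def algebra_simps sum.distrib)

lemma cform_add_right: "cform A w (x + y) = cform A w x + cform A w y"
  by (simp add: cform_def algebra_simps sum.distrib matrix_vector_right_distrib)

lemma cform_scale_left: "cform A (c *s x) y = cnj c * cform A x y"
  by (simp add: cform_def algebra_simps sum_distrib_left)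

lemma cform_scale_right: "cform A x (c *s y) = c * cform A x y"
  by (simp add: cform_def algebra_simps sum_distrib_left vector_scalar_commute)

lemma cform_zero_right [simp]: "cform A x 0 = 0"
  by (simp add: cform_def)

lemma cform_sum_right: "cform A x (\<Sum>i\<in>I. f i) = (\<Sum>i\<in>I. cform A x (f i))"
  by (induction I rule: infinite_finite_induct) (auto simp: cform_add_right)

lemma cform_matrix_add: "cform (A + B) x y = cform A x y + cform B x y"
  by (simp add: cform_def algebra_simps sum.distrib matrix_vector_mult_add_rdistrib)

lemma cform_eq_double_sum:
  "cform A x y = (\<Sum>i\<in>UNIV. \<Sum>j\<in>UNIV. cnj (x $ i) * A $ i $ j * y $ j)"
  by (simp add: cform_def matrix_vector_mult_def sum_distrib_left mult.assoc)

lemma cform_matrix_scaleR: "cform (c *\<^sub>R A) x y = c * cform A x y"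
  unfolding cform_eq_double_sum vector_scaleR_component
  by (simp add: sum_distrib_left scaleR_conv_of_real algebra_simps)

lemma cform_conj_transpose: "cform (conj_transpose A) x y = cnj (cform A y x)"
  unfolding cform_eq_double_sum conj_transpose_def
  by (subst sum.swap) (simp add: algebra_simps)

lemma cform_congruence:
  fixes A T :: "complex ^ 'n ^ 'n"
  shows "cform (conj_transpose T ** A ** T) x y = cform A (T *v x) (T *v y)"
proof -
  have "cform (conj_transpose T ** A ** T) x y = cform (conj_transpose T) x (A *v (T *v y))"
    by (simp add: cform_def matrix_vector_mul_assoc matrix_mul_assoc)
  also have "\<dots> = cnj (cform T (A *v (T *v y)) x)"
    by (rule cform_conj_transpose)
  also have "\<dots> = cform A (T *v x) (T *v y)"
    by (simp add: cform_def mult.commute)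
  finally show ?thesis .
qed

lemma cform_diag_cis:
  "cform (diag_cis \<phi>) x x = (\<Sum>i\<in>UNIV. (cmod (x $ i))\<^sup>2 * cis (\<phi> i))"
  unfolding cform_eq_double_sum diag_cis_def
  by (simp add: if_distrib if_distribR sum.delta complex_norm_square[symmetric] mult_ac
      del: of_real_power cong: if_cong)

lemma continuous_on_cform [continuous_intros]:
  assumes "continuous_on S f" "continuous_on S g"
  shows "continuous_on S (\<lambda>x. cform A (f x) (g x))"
  unfolding cform_eq_double_sum by (intro continuous_intros assms)

text \<open>Cauchy-Schwarz argument for a semidefinite form. Nonnegativity is asked only at
  \<open>y\<close> and along \<open>x + c *s y\<close>, because it will be available only on a
  subspace.\<close>

lemma cform_semidefinite_null:
  assumes herm: "conj_transpose G = G"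
    and nonneg: "\<And>c. 0 \<le> Re (cform G (x + c *s y) (x + c *s y))" "0 \<le> Re (cform G y y)"
    and null: "cform G x x = 0"
  shows "cform G x y = 0"
proof (rule ccontr)
  assume ne: "cform G x y \<noteq> 0"
  define a b where "a = cform G x y" and "b = Re (cform G y y)"
  \<comment> \<open>With the \<open>c\<close> below, both cross terms equal
    \<open>- t * (cmod a)^2\<close>; this \<open>t\<close>, legitimate also for
    \<open>b = 0\<close>, keeps the quadratic term smaller than their total, so the form becomes
    negative.\<close>
  define t where "t = 1 / (b + 1)"
  define c where "c = - of_real t * cnj a"
  have b: "b \<ge> 0" using nonneg(2) by (simp add: b_def)
  then have t: "t > 0" "t * b < 1" by (auto simp: t_def field_simps)
  have yx: "cform G y x = cnj a"
    using cform_conj_transpose[of G y x] herm by (simp add: a_def)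
  have "cform G (x + c *s y) (x + c *s y)
      = c * a + cnj c * cnj a + cnj c * c * cform G y y"
    by (simp add: cform_add_left cform_add_right cform_scale_left cform_scale_right null yx
        a_def[symmetric] algebra_simps)
  also have "Re \<dots> = (cmod a)\<^sup>2 * (t * (t * b - 2))"
    unfolding c_def b_def cmod_power2
    by (simp add: power2_eq_square algebra_simps)
  finally have "0 \<le> (cmod a)\<^sup>2 * (t * (t * b - 2))"
    using nonneg(1)[of c] by simp
  moreover have "t * (t * b - 2) < 0" using t by (intro mult_pos_neg) auto
  moreover have "(cmod a)\<^sup>2 > 0" using ne by (simp add: a_def)
  ultimately show False by (smt (verit) mult_pos_neg)
qed

text \<open>Solves fewer homogeneous equations than unknowns: the equations fill the other rows of a
  square matrix whose row \<open>k\<close> is zero.\<close>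

lemma matrix_zero_row_kernel:
  fixes A :: "'a::field ^ 'n ^ 'n"
  assumes "row k A = 0"
  obtains x where "x \<noteq> 0" "A *v x = 0"
proof -
  have "det A = 0" using assms by (rule det_zero_row(2))
  then have "\<not> invertible A" by (simp add: invertible_det_nz)
  then show thesis
    using that matrix_left_invertible_ker[of A] invertible_left_inverse[of A] by blast
qed

section \<open>Simultaneous diagonalization\<close>

lemma complex_scalar_mult_of_real:
  fixes y :: "complex ^ 'n"
  shows "complex_of_real a *s y = a *\<^sub>R y"
  unfolding vec_eq_iff vector_scaleR_component vector_smult_component
  by (simp add: scaleR_conv_of_real)

text \<open>The quotient of the two forms is unchanged by scaling, so its maximum over
  \<open>V\<close> is attained on the compact set of unit vectors in \<open>V\<close>.\<close>

lemma exists_maximal_generalized_eigenvalue: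
  fixes H K :: "complex ^ 'n ^ 'n"
  assumes pd: "\<And>x. x \<noteq> 0 \<Longrightarrow> Re (cform H x x) > 0"
    and closed: "closed V"
    and scale: "\<And>c y. y \<in> V \<Longrightarrow> c *s y \<in> V"
    and nontrivial: "v \<in> V" "v \<noteq> 0"
  shows "\<exists>x l. x \<in> V \<and> x \<noteq> 0 \<and> Re (cform K x x) = l * Re (cform H x x) \<and>
    (\<forall>y\<in>V. Re (cform K y y) \<le> l * Re (cform H y y))"
proof -
  define f where "f y = Re (cform K y y) / Re (cform H y y)" for y
  have normalize: "f (of_real (inverse (norm y)) *s y) = f y"
    "of_real (inverse (norm y)) *s y \<in> V \<inter> sphere 0 1" if "y \<in> V" "y \<noteq> 0" for y
  proof -
    have "norm (complex_of_real (inverse (norm y)) *s y) = 1"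
      unfolding complex_scalar_mult_of_real
      using that by simp
    then show "of_real (inverse (norm y)) *s y \<in> V \<inter> sphere 0 1"
      using scale that by auto
    show "f (of_real (inverse (norm y)) *s y) = f y"
      using that by (simp add: f_def cform_scale_left cform_scale_right)
  qed
  have "Re (cform H y y) \<noteq> 0" if "y \<in> V \<inter> sphere 0 1" for y
    using pd[of y] that by (cases "y = 0") auto
  then have "continuous_on (V \<inter> sphere 0 1) f"
    unfolding f_def by (intro continuous_intros) auto
  moreover have "compact (V \<inter> sphere 0 1)"
    using closed by (simp add: closed_Int_compact)
  moreover have "V \<inter> sphere 0 1 \<noteq> {}"
    using normalize nontrivial by blast
  ultimately obtain x where x: "x \<in> V \<inter> sphere 0 1"
    and max: "\<And>y. y \<in> V \<inter> sphere 0 1 \<Longrightarrow> f y \<le> f x"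
    using continuous_attains_sup[of "V \<inter> sphere 0 1" f] by blast
  show ?thesis
  proof (intro exI conjI ballI)
    show "x \<in> V" "x \<noteq> 0" using x by auto
    then show "Re (cform K x x) = f x * Re (cform H x x)"
      using pd[of x] by (simp add: f_def)
    fix y assume y: "y \<in> V"
    show "Re (cform K y y) \<le> f x * Re (cform H y y)"
    proof (cases "y = 0")
      case False
      then have "f y \<le> f x" using max normalize y by metis
      then show ?thesis using pd[OF False] by (simp add: f_def field_simps)
    qed simp
  qed
qed

lemma Im_cform_hermitian:
  assumes "conj_transpose H = H"
  shows "Im (cform H x x) = 0"
  using cform_conj_transpose[of H x x] assms by (simp add: complex_eq_iff)

lemma exists_common_form_kernel:
  fixes x :: "'n \<Rightarrow> complex ^ 'n"
  assumes "b \<notin> A"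
  obtains v where "v \<noteq> 0" "\<And>i. i \<in> A \<Longrightarrow> cform H (x i) v = 0"
proof -
  define G where
    "G = (\<chi> i j. if i \<in> A then \<Sum>k\<in>UNIV. cnj (x i $ k) * H $ k $ j else 0)"
  have "row b G = 0" using assms by (simp add: G_def row_def vec_eq_iff)
  then obtain v where v: "v \<noteq> 0" "G *v v = 0" by (rule matrix_zero_row_kernel)
  have "cform H (x i) v = (G *v v) $ i" if "i \<in> A" for i
    unfolding cform_eq_double_sum using that
    by (subst sum.swap) (simp add: G_def matrix_vector_mult_def sum_distrib_right)
  with v show thesis by (intro that[of v]) auto
qed

lemma closed_common_form_kernel: "closed {y. \<forall>j\<in>A. cform H (x j) y = 0}"
  unfolding Ball_def
proof (intro closed_Collect_all closed_Collect_imp open_Collect_const closed_Collect_eq)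
  show "continuous_on UNIV (cform H (x j))" for j
    by (intro continuous_intros)
qed (rule continuous_on_const)

text \<open>Invariant of a greedy construction. For Hermitian forms the second clause is the
  eigenvector equation \<open>K x_i = l_i H x_i\<close>; the last bounds the quotient on the
  \<open>H\<close>-orthogonal complement, so that the next maximum cannot exceed the earlier
  values.\<close>

definition partial_diagonalization ::
  "(complex, 'n :: {finite, linorder}) sq_matrix \<Rightarrow> (complex, 'n) sq_matrix \<Rightarrow> 'n set \<Rightarrow>
    ('n \<Rightarrow> (complex, 'n) vec) \<Rightarrow> ('n \<Rightarrow> real) \<Rightarrow> bool"
where
  "partial_diagonalization H K A x l \<longleftrightarrow>
    (\<forall>i\<in>A. \<forall>j\<in>A. cform H (x i) (x j) = (if i = j then 1 else 0)) \<and>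
    (\<forall>i\<in>A. \<forall>y. cform K (x i) y = complex_of_real (l i) * cform H (x i) y) \<and>
    (\<forall>i\<in>A. \<forall>j\<in>A. i \<le> j \<longrightarrow> l j \<le> l i) \<and>
    (\<forall>i\<in>A. \<forall>y. (\<forall>j\<in>A. cform H (x j) y = 0) \<longrightarrow>
      Re (cform K y y) \<le> l i * Re (cform H y y))"

text \<open>Indices are added in increasing order; each new vector maximizes the quotient of
  \<open>K\<close> by \<open>H\<close> on the \<open>H\<close>-orthogonal complement of its
  predecessors, which makes it an eigenvector.\<close>

lemma exists_partial_diagonalization:
  fixes H K :: "(complex, 'n :: {finite, linorder}) sq_matrix" and A :: "'n set"
  assumes H: "conj_transpose H = H" and K: "conj_transpose K = K"
    and pd: "\<And>x. x \<noteq> 0 \<Longrightarrow> Re (cform H x x) > 0"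
  shows "\<exists>x l. partial_diagonalization H K A x l"
proof -
  have "finite A" by simp
  then show ?thesis
  proof (induction A rule: finite_linorder_max_induct)
    case empty
    show ?case by (simp add: partial_diagonalization_def)
  next
    case (insert b A)
    then have bA: "b \<notin> A" by auto
    from insert.IH obtain x l where IH: "partial_diagonalization H K A x l" by blast
    have orth: "cform H (x i) (x j) = (if i = j then 1 else 0)" if "i \<in> A" "j \<in> A" for i j
      using IH that by (simp add: partial_diagonalization_def)
    have eig: "cform K (x i) y = of_real (l i) * cform H (x i) y" if "i \<in> A" for i y
      using IH that by (simp add: partial_diagonalization_def)
    have ord: "l j \<le> l i" if "i \<in> A" "j \<in> A" "i \<le> j" for i j
      using IH that by (simp add: partial_diagonalization_def)
    have bound: "Re (cform K y y) \<le> l i * Re (cform H y y)"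
      if "i \<in> A" "\<forall>j\<in>A. cform H (x j) y = 0" for i y
      using IH that by (simp add: partial_diagonalization_def)
    define V where "V = {y. \<forall>j\<in>A. cform H (x j) y = 0}"
    have V_add: "y + c *s w \<in> V" if "y \<in> V" "w \<in> V" for y w c
      using that by (simp add: V_def cform_add_right cform_scale_right)
    have V_scale: "c *s w \<in> V" if "w \<in> V" for w c
      using that by (simp add: V_def cform_scale_right)
    have "closed V" unfolding V_def by (rule closed_common_form_kernel)
    obtain v0 where "v0 \<noteq> 0" "\<And>j. j \<in> A \<Longrightarrow> cform H (x j) v0 = 0"
      using exists_common_form_kernel[OF bA, of H x] by blast
    then have v0: "v0 \<in> V" "v0 \<noteq> 0" by (simp_all add: V_def)
    obtain v m where "v \<in> V \<and> v \<noteq> 0 \<and> Re (cform K v v) = m * Re (cform H v v) \<and>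
        (\<forall>y\<in>V. Re (cform K y y) \<le> m * Re (cform H y y))"
      using exists_maximal_generalized_eigenvalue[OF pd \<open>closed V\<close> V_scale v0, of K]
      by blast
    then have v: "v \<in> V" "v \<noteq> 0"
      "Re (cform K v v) = m * Re (cform H v v)"
      and max: "\<And>y. y \<in> V \<Longrightarrow> Re (cform K y y) \<le> m * Re (cform H y y)"
      by auto
    \<comment> \<open>The form \<open>m H - K\<close> is nonnegative on \<open>V\<close> and
      vanishes at the maximizer \<open>v\<close>, so it pairs \<open>v\<close> to zero with all of
      \<open>V\<close>: the eigenvector equation tested on \<open>V\<close>.\<close>
    define G where "G = m *\<^sub>R H + (-1) *\<^sub>R K"
    have G: "cform G y w = m * cform H y w - cform K y w" for y w
      unfolding G_def cform_matrix_add cform_matrix_scaleR by simp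
    have G_herm: "conj_transpose G = G"
      using H K by (simp add: G_def conj_transpose_def vec_eq_iff)
    have G_nonneg: "0 \<le> Re (cform G y y)" if "y \<in> V" for y
      using max[OF that] by (simp add: G)
    have G_null: "cform G v v = 0"
      using v(3) Im_cform_hermitian[OF H] Im_cform_hermitian[OF K]
      by (simp add: G complex_eq_iff)
    have G_V: "cform G v y = 0" if "y \<in> V" for y
      using cform_semidefinite_null[OF G_herm, of v y] G_nonneg G_null V_add v(1) that
      by blast
    have v_orth: "cform H v (x j) = 0" "cform K v (x j) = 0" if "j \<in> A" for j
    proof -
      have Hxv: "cform H (x j) v = 0" using v(1) that by (simp add: V_def)
      then show "cform H v (x j) = 0"
        using cform_conj_transpose[of H v "x j"] H by simp
      show "cform K v (x j) = 0"
        using cform_conj_transpose[of K v "x j"] K eig[OF that, of v] Hxv by simp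
    qed
    have G_all: "cform G v y = 0" for y
    proof -
      \<comment> \<open>The \<open>H\<close>-orthogonal projection of \<open>y\<close> to the span
        of the earlier vectors; \<open>y - s\<close> lies in \<open>V\<close>, while
        \<open>v\<close> is orthogonal to \<open>s\<close> under both forms.\<close>
      define s where "s = (\<Sum>j\<in>A. cform H (x j) y *s x j)"
      have "cform H (x i) (y - s) = 0" if "i \<in> A" for i
      proof -
        have "cform H (x i) s = (\<Sum>j\<in>A. if j = i then cform H (x i) y else 0)"
          unfolding s_def cform_sum_right
          by (intro sum.cong) (auto simp: cform_scale_right orth that)
        also have "\<dots> = cform H (x i) y" using that by simp
        finally have "cform H (x i) s = cform H (x i) y" .
        moreover have "cform H (x i) (y - s + s) = cform H (x i) (y - s) + cform H (x i) s"
          by (rule cform_add_right)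
        ultimately show ?thesis by simp
      qed
      then have "cform G v (y - s) = 0" by (intro G_V) (simp add: V_def)
      moreover have "cform G v s = 0"
        unfolding s_def cform_sum_right
        by (intro sum.neutral) (simp add: cform_scale_right G v_orth)
      ultimately show ?thesis
        using cform_add_right[of G v "y - s" s] by simp
    qed
    define h where "h = Re (cform H v v)"
    define u where "u = complex_of_real (1 / sqrt h) *s v"
    have h: "h > 0" using pd v by (simp add: h_def)
    have Hvv: "cform H v v = of_real h"
      using Im_cform_hermitian[OF H] by (simp add: h_def complex_eq_iff)
    have "cform H u u = of_real ((1 / sqrt h) * ((1 / sqrt h) * h))"
      by (simp only: u_def cform_scale_left cform_scale_right Hvv complex_cnj_complex_of_real
          of_real_mult)
    also have "(1 / sqrt h) * ((1 / sqrt h) * h) = 1" using h by simp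
    finally have Huu: "cform H u u = 1" by simp
    have Hxu: "cform H (x j) u = 0" "cform H u (x j) = 0" if "j \<in> A" for j
      using v(1) v_orth[OF that] that
      by (auto simp: u_def V_def cform_scale_left cform_scale_right)
    have u_eig: "cform K u y = of_real m * cform H u y" for y
      using G_all[of y] by (simp add: G u_def cform_scale_left)
    have ml: "m \<le> l i" if "i \<in> A" for i
    proof -
      have "m * h \<le> l i * h"
        using bound[OF that, of v] v by (simp add: V_def h_def)
      then show ?thesis using h by simp
    qed
    define x' l' where "x' = x(b := u)" and "l' = l(b := m)"
    have x': "x' b = u" "l' b = m" "\<And>i. i \<in> A \<Longrightarrow> x' i = x i" "\<And>i. i \<in> A \<Longrightarrow> l' i = l i"
      using bA by (auto simp: x'_def l'_def)
    have "\<forall>i\<in>insert b A. \<forall>j\<in>insert b A. cform H (x' i) (x' j) = (if i = j then 1 else 0)"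
      using bA by (auto simp: x' orth Huu Hxu)
    moreover have "\<forall>i\<in>insert b A. \<forall>y. cform K (x' i) y = of_real (l' i) * cform H (x' i) y"
      by (auto simp: x' eig u_eig)
    moreover have "\<forall>i\<in>insert b A. \<forall>j\<in>insert b A. i \<le> j \<longrightarrow> l' j \<le> l' i"
      using insert.hyps(2) by (auto simp: x' ord ml)
    moreover have "\<forall>i\<in>insert b A. \<forall>y. (\<forall>j\<in>insert b A. cform H (x' j) y = 0) \<longrightarrow>
        Re (cform K y y) \<le> l' i * Re (cform H y y)"
      using max bound by (auto simp: x' V_def)
    ultimately show ?case
      unfolding partial_diagonalization_def by (intro exI[of _ x'] exI[of _ l'] conjI)
  qed
qed

lemma cform_axis:
  fixes C :: "complex ^ 'n ^ 'n"
  shows "cform C (axis i 1) (axis j 1) = C $ i $ j"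
  by (simp add: cform_def axis_def if_distrib cong: if_cong)
    (simp add: matrix_vector_mult_def if_distrib if_distribR cong: if_cong)

lemma matrix_eq_of_cform:
  fixes A B :: "complex ^ 'n ^ 'n"
  assumes "\<And>x y. cform A x y = cform B x y"
  shows "A = B"
  using assms by (simp add: vec_eq_iff flip: cform_axis)

section \<open>Phases\<close>

lemma det_diag_cis_nonzero: "det (diag_cis \<phi>) \<noteq> 0"
  by (subst det_diagonal) (auto simp: diag_cis_def)

text \<open>\<open>H\<close> is half of \<open>D + D^*\<close>, and \<open>K\<close> is
  \<open>- \<i> / 2\<close> times \<open>D - D^*\<close>.\<close>

lemma cartesian_decomposition:
  fixes D :: "complex ^ 'n ^ 'n"
  obtains H K where "conj_transpose H = H" "conj_transpose K = K"
    "\<And>x y. cform D x y = cform H x y + \<i> * cform K x y"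
proof (rule that)
  let ?H = "\<chi> i j. (D $ i $ j + cnj (D $ j $ i)) / 2"
  let ?K = "\<chi> i j. \<i> * (cnj (D $ j $ i) - D $ i $ j) / 2"
  show "conj_transpose ?H = ?H" "conj_transpose ?K = ?K"
    by (auto simp: conj_transpose_def vec_eq_iff complex_eq_iff field_simps)
  have decomp: "cform D x y = cform H x y + \<i> * cform K x y"
    if "\<And>i j. D $ i $ j = H $ i $ j + \<i> * K $ i $ j" for x y and H K :: "complex ^ 'n ^ 'n"
    by (simp add: cform_eq_double_sum that sum_distrib_left sum.distrib algebra_simps)
  show "cform D x y = cform ?H x y + \<i> * cform ?K x y" for x y
    by (rule decomp) (simp add: complex_eq_iff field_simps)
qed

text \<open>In the \<open>H\<close>-orthonormal basis \<open>x\<close> the form of \<open>D\<close>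
  is diagonal with entries \<open>1 + \<i> * l i\<close>. Rescaling the basis removes the moduli,
  and \<open>T\<close> is the inverse of the matrix with the rescaled vectors as columns.\<close>

lemma exists_phase_decomposition:
  fixes D :: "(complex, 'n :: {finite, linorder}) sq_matrix"
  assumes pd: "\<And>x. x \<noteq> 0 \<Longrightarrow> Re (cform D x x) > 0"
  obtains T :: "(complex, 'n) sq_matrix" and \<phi> where "antimono \<phi>" "\<And>i. - pi / 2 < \<phi> i \<and> \<phi> i < pi / 2"
    "invertible T" "D = conj_transpose T ** diag_cis \<phi> ** T"
proof -
  obtain H K where H: "conj_transpose H = H" and K: "conj_transpose K = K"
    and D: "\<And>x y. cform D x y = cform H x y + \<i> * cform K x y"
    using cartesian_decomposition by blast
  have "Re (cform H x x) > 0" if "x \<noteq> 0" for x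
    using pd[OF that] Im_cform_hermitian[OF K] by (simp add: D)
  then obtain x l where "partial_diagonalization H K UNIV x l"
    using exists_partial_diagonalization[OF H K] by blast
  then have orth: "cform H (x i) (x j) = (if i = j then 1 else 0)"
    and eig: "cform K (x i) y = of_real (l i) * cform H (x i) y"
    and ord: "i \<le> j \<Longrightarrow> l j \<le> l i" for i j y
    by (simp_all add: partial_diagonalization_def)
  \<comment> \<open>\<open>1 + \<i> * l i\<close> has argument \<open>arctan (l i)\<close> and
    modulus \<open>1 / cos (\<phi> i)\<close>; the scaling factor enters the form twice, hence the
    square root.\<close>
  define \<phi> where "\<phi> i = arctan (l i)" for i
  define y where "y i = complex_of_real (sqrt (cos (\<phi> i))) *s x i" for i
  define P where "P = (\<chi> i j. y j $ i)"
  have cos_pos: "cos (\<phi> i) > 0" for i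
    using arctan_bounded[of "l i"] by (auto simp: \<phi>_def cos_gt_zero_pi)
  have "sin (\<phi> i) = cos (\<phi> i) * l i" for i
    using cos_pos[of i] tan_arctan[of "l i"] by (simp add: \<phi>_def tan_def field_simps)
  then have cis_eq: "cis (\<phi> i) = of_real (cos (\<phi> i)) * (1 + \<i> * of_real (l i))" for i
    by (simp add: complex_eq_iff)
  have sqrt_sq: "complex_of_real (sqrt (cos (\<phi> i))) * (complex_of_real (sqrt (cos (\<phi> i))) * w)
      = of_real (cos (\<phi> i)) * w" for i w
    using cos_pos[of i] by (simp add: mult.assoc[symmetric] flip: of_real_mult)
  have y_orth: "cform D (y i) (y j) = (if i = j then cis (\<phi> i) else 0)" for i j
    by (simp add: y_def cform_scale_left cform_scale_right D eig orth cis_eq sqrt_sq)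
  have P_axis: "P *v axis j 1 = y j" for j
    by (simp add: vec_eq_iff P_def matrix_vector_mult_def axis_def if_distrib cong: if_cong)
  have "(conj_transpose P ** D ** P) $ i $ j = diag_cis \<phi> $ i $ j" for i j
    unfolding cform_axis[of "conj_transpose P ** D ** P", symmetric] cform_congruence P_axis y_orth
    by (simp add: diag_cis_def)
  then have PDP: "conj_transpose P ** D ** P = diag_cis \<phi>"
    by (simp add: vec_eq_iff)
  then have "det (conj_transpose P) * det D * det P \<noteq> 0"
    using det_diag_cis_nonzero[of \<phi>] by (simp flip: det_mul)
  then have "invertible P" by (simp add: invertible_det_nz)
  then obtain T where T: "P ** T = mat 1" "T ** P = mat 1" by (auto simp: invertible_def)
  then have PT: "P *v (T *v w) = w" for w by (simp add: matrix_vector_mul_assoc)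
  show thesis
  proof (rule that[of \<phi> T])
    show "antimono \<phi>" by (intro antimonoI) (simp add: \<phi>_def ord arctan_le_iff)
    show "- pi / 2 < \<phi> i \<and> \<phi> i < pi / 2" for i
      using arctan_bounded[of "l i"] by (simp add: \<phi>_def)
    show "invertible T"
      using T by (auto simp: invertible_def)
    show "D = conj_transpose T ** diag_cis \<phi> ** T"
      by (rule matrix_eq_of_cform) (simp add: cform_congruence PT flip: PDP)
  qed
qed

text \<open>Rotating by \<open>- \<theta>\<close> turns the comparison of an argument with
  \<open>\<theta>\<close> into a sign, which can be read off from the sines term by term.\<close>

lemma Im_rotated_diag_cis:
  "Im (cis (- \<theta>) * cform (diag_cis \<phi>) x x)
    = (\<Sum>i\<in>UNIV. (cmod (x $ i))\<^sup>2 * sin (\<phi> i - \<theta>))"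
  unfolding cform_diag_cis sum_distrib_left Im_sum
  by (intro sum.cong refl) (simp add: sin_diff algebra_simps flip: of_real_power)

text \<open>
  Courant--Fischer argument: the first form has angle at least \<open>\<phi> k\<close> on the subspace where the
  coordinates of \<open>T *v x\<close> after \<open>k\<close> vanish, and the second one has angle at most \<open>\<psi> k\<close> where
  those of \<open>S *v x\<close> before \<open>k\<close> vanish; these \<open>n - 1\<close> equations have a common solution \<open>x \<noteq> 0\<close>.
\<close>

lemma phase_decomposition_le:
  fixes S T :: "(complex, 'n :: {finite, linorder}) sq_matrix"
  assumes eq: "conj_transpose T ** diag_cis \<phi> ** T = conj_transpose S ** diag_cis \<psi> ** S"
    and "invertible S"
    and "antimono \<phi>" "antimono \<psi>"
    and \<phi>: "\<And>i. - pi / 2 < \<phi> i \<and> \<phi> i < pi / 2"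
    and \<psi>: "\<And>i. - pi / 2 < \<psi> i \<and> \<psi> i < pi / 2"
  shows "\<phi> k \<le> \<psi> k"
proof (rule ccontr)
  assume less: "\<not> \<phi> k \<le> \<psi> k"
  define G where "G = (\<chi> i. if k < i then T $ i else if i < k then S $ i else 0)"
  have "row k G = 0" by (simp add: G_def row_def vec_eq_iff)
  then obtain x where x: "x \<noteq> 0" "G *v x = 0" by (rule matrix_zero_row_kernel)
  have G: "(G *v x) $ i = (if k < i then (T *v x) $ i else if i < k then (S *v x) $ i else 0)" for i
    by (simp add: G_def matrix_vector_mult_def)
  have Tx: "(T *v x) $ i = 0" if "k < i" for i
    using G[of i] x that by simp
  have Sx: "(S *v x) $ i = 0" if "i < k" for i
    using G[of i] x(2) that by (simp split: if_splits)
  have "S *v x \<noteq> 0"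
    using x(1) \<open>invertible S\<close> invertible_left_inverse matrix_left_invertible_ker by blast
  \<comment> \<open>This nonzero coordinate supplies strictness: its index is at least
    \<open>k\<close>, where the sine is negative.\<close>
  then obtain m where m: "(S *v x) $ m \<noteq> 0" by (auto simp: vec_eq_iff)
  have "0 \<le> (\<Sum>i\<in>UNIV. (cmod ((T *v x) $ i))\<^sup>2 * sin (\<phi> i - \<phi> k))"
  proof (rule sum_nonneg)
    fix i
    show "0 \<le> (cmod ((T *v x) $ i))\<^sup>2 * sin (\<phi> i - \<phi> k)"
    proof (cases "k < i")
      case False
      then have "\<phi> k \<le> \<phi> i" using \<open>antimono \<phi>\<close> by (simp add: antimonoD)
      then have "0 \<le> sin (\<phi> i - \<phi> k)"
        using \<phi>[of i] \<phi>[of k] by (intro sin_ge_zero) auto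
      then show ?thesis by simp
    qed (simp add: Tx)
  qed
  also have "\<dots> = Im (cis (- \<phi> k) * cform (conj_transpose T ** diag_cis \<phi> ** T) x x)"
    by (simp only: cform_congruence Im_rotated_diag_cis)
  also have "\<dots> = (\<Sum>i\<in>UNIV. (cmod ((S *v x) $ i))\<^sup>2 * sin (\<psi> i - \<phi> k))"
    unfolding eq by (simp only: cform_congruence Im_rotated_diag_cis)
  also have "\<dots> < (\<Sum>i\<in>(UNIV :: 'n set). 0)"
  proof -
    have neg: "sin (\<psi> i - \<phi> k) < 0" if "k \<le> i" for i
    proof -
      have "\<psi> i \<le> \<psi> k" using \<open>antimono \<psi>\<close> that by (simp add: antimonoD)
      then have "0 < sin (\<phi> k - \<psi> i)"
        using less \<phi>[of k] \<psi>[of i] by (intro sin_gt_zero) auto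
      then show ?thesis using sin_minus[of "\<phi> k - \<psi> i"] by simp
    qed
    have "(cmod ((S *v x) $ i))\<^sup>2 * sin (\<psi> i - \<phi> k) \<le> 0" for i
      using neg[of i] Sx[of i] by (cases "i < k") (auto simp: mult_le_0_iff not_less)
    moreover have "k \<le> m" using Sx m not_le by blast
    then have "(cmod ((S *v x) $ m))\<^sup>2 * sin (\<psi> m - \<phi> k) < 0"
      using m neg by (simp add: mult_pos_neg)
    ultimately show ?thesis by (intro sum_strict_mono_ex1) auto
  qed
  finally show False by simp
qed

section \<open>Positivity for real matrices and well-definedness of the phases\<close>

lemma Re_cform_complexify:
  "Re (cform (complexify A) x x) =
    (\<chi> i. Re (x $ i)) \<bullet> (A *v (\<chi> i. Re (x $ i))) + (\<chi> i. Im (x $ i)) \<bullet> (A *v (\<chi> i. Im (x $ i)))"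
  unfolding cform_eq_double_sum inner_vec_def matrix_vector_mult_def
  by (simp add: sum_distrib_left sum.distrib[symmetric] algebra_simps)

lemma positive_definite_symmetric_part:
  assumes "positive_definite (A + transpose A)" "x \<noteq> 0"
  shows "x \<bullet> (A *v x) > 0"
proof -
  have "x \<bullet> (transpose A *v x) = x \<bullet> (A *v x)"
    by (metis dot_lmul_matrix inner_commute vector_transpose_matrix)
  moreover have "x \<bullet> ((A + transpose A) *v x) > 0"
    using assms by (simp add: positive_definite_def)
  ultimately show ?thesis
    by (simp add: matrix_vector_mult_add_rdistrib inner_add_right)
qed

lemma Re_cform_pos:
  assumes pd: "positive_definite (A + transpose A)" and "x \<noteq> 0"
  shows "Re (cform (complexify A) x x) > 0"
proof -
  let ?u = "\<chi> i. Re (x $ i)" and ?v = "\<chi> i. Im (x $ i)"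
  have nonneg: "w \<bullet> (A *v w) \<ge> 0" for w
    using positive_definite_symmetric_part[OF pd, of w] by (cases "w = 0") auto
  have "?u \<noteq> 0 \<or> ?v \<noteq> 0"
    using \<open>x \<noteq> 0\<close> by (auto simp: vec_eq_iff complex_eq_iff)
  then show ?thesis
    using nonneg[of ?u] nonneg[of ?v] positive_definite_symmetric_part[OF pd, of ?u]
      positive_definite_symmetric_part[OF pd, of ?v]
    unfolding Re_cform_complexify by linarith
qed

text \<open>Justifies the definite description in \<open>phases\<close>: existence comes from the
  simultaneous diagonalization, uniqueness from comparing two families in both directions.\<close>

lemma is_phases_phases:
  fixes A :: "(real, 'n :: {finite, linorder}) sq_matrix"
  assumes "positive_definite (A + transpose A)"
  shows "is_phases A (phases A)"
proof -
  have "\<exists>\<phi>. is_phases A \<phi>"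
  proof (rule exists_phase_decomposition[OF Re_cform_pos[OF assms]])
    fix T :: "(complex, 'n) sq_matrix" and \<phi> :: "'n \<Rightarrow> real"
    assume "antimono \<phi>" "\<And>i. - pi / 2 < \<phi> i \<and> \<phi> i < pi / 2" "invertible T"
      "complexify A = conj_transpose T ** diag_cis \<phi> ** T"
    then have "is_phases A \<phi>" unfolding is_phases_def by blast
    then show ?thesis by blast
  qed
  moreover have "\<phi> = \<psi>" if "is_phases A \<phi>" "is_phases A \<psi>" for \<phi> \<psi>
  proof (intro ext antisym)
    fix i
    show "\<phi> i \<le> \<psi> i" "\<psi> i \<le> \<phi> i"
      using that phase_decomposition_le[of _ \<phi> _ \<psi> i] phase_decomposition_le[of _ \<psi> _ \<phi> i]
      unfolding is_phases_def by metis+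
  qed
  ultimately have "\<exists>!\<phi>. is_phases A \<phi>" by blast
  then show ?thesis unfolding phases_def by (rule theI')
qed

text \<open>One half of the variational description of the largest phase: after rotation by
  \<open>- \<phi> first_index\<close> every diagonal term has nonpositive imaginary part. The
  tangent form avoids division and includes \<open>x = 0\<close>.\<close>

lemma numerical_range_angle_le:
  fixes A :: "(real, 'n :: {finite, linorder}) sq_matrix"
  assumes "is_phases A \<phi>"
  shows "Im (cform (complexify A) x x) \<le> tan (\<phi> first_index) * Re (cform (complexify A) x x)"
proof -
  let ?\<theta> = "\<phi> first_index" and ?w = "cform (complexify A) x x"
  obtain T where T: "complexify A = conj_transpose T ** diag_cis \<phi> ** T"
    and \<phi>: "antimono \<phi>" "\<And>i. - pi / 2 < \<phi> i \<and> \<phi> i < pi / 2"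
    using assms by (auto simp: is_phases_def)
  have "\<phi> i \<le> ?\<theta>" for i
    using \<phi>(1) by (simp add: antimonoD first_index_def)
  then have "0 \<le> sin (?\<theta> - \<phi> i)" for i
    using \<phi>(2)[of i] \<phi>(2)[of first_index] by (intro sin_ge_zero) (auto simp: algebra_simps)
  then have "sin (\<phi> i - ?\<theta>) \<le> 0" for i
    using sin_minus[of "?\<theta> - \<phi> i"] by (metis minus_diff_eq neg_le_0_iff_le)
  then have "Im (cis (- ?\<theta>) * ?w) \<le> 0"
    unfolding T cform_congruence Im_rotated_diag_cis
    by (intro sum_nonpos mult_nonneg_nonpos) auto
  moreover have "cos ?\<theta> > 0"
    using \<phi>(2)[of first_index] by (simp add: cos_gt_zero_pi)
  ultimately show ?thesis by (simp add: tan_def field_simps)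
qed

section \<open>The plane spanned by a vector and its conjugate\<close>

definition vec_cnj :: "complex ^ 'n \<Rightarrow> complex ^ 'n" where
  "vec_cnj x = (\<chi> i. cnj (x $ i))"

text \<open>Holds because the entries of \<open>A\<close> are real; it ties the form at conjugate
  vectors to the conjugate value.\<close>

lemma complexify_mult_vec_cnj: "complexify A *v vec_cnj x = vec_cnj (complexify A *v x)"
  by (simp add: vec_eq_iff vec_cnj_def matrix_vector_mult_def)

lemma cform_vec_cnj:
  "cform (complexify A) (vec_cnj x) (vec_cnj y) = cnj (cform (complexify A) x y)"
  by (simp add: cform_def complexify_mult_vec_cnj) (simp add: vec_cnj_def)

lemma vec_cnj_vec_cnj [simp]: "vec_cnj (vec_cnj x) = x"
  by (simp add: vec_cnj_def vec_eq_iff)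

lemma diag_cis_mult_vec: "(diag_cis \<theta> *v x) $ j = cis (\<theta> j) * x $ j"
  by (simp add: diag_cis_def matrix_vector_mult_def if_distrib if_distribR cong: if_cong)

lemma matrix_inv_eq_right_inverse:
  fixes A B :: "'a :: field ^ 'n ^ 'n"
  assumes "A ** B = mat 1"
  shows "matrix_inv A = B"
proof -
  have "A ** B = mat 1 \<and> B ** A = mat 1"
    using assms matrix_left_right_inverse[of A B] by simp
  then have "A ** matrix_inv A = mat 1 \<and> matrix_inv A ** A = mat 1"
    unfolding matrix_inv_def by (rule someI)
  then have "B = (matrix_inv A ** A) ** B" by simp
  also have "\<dots> = matrix_inv A"
    unfolding matrix_mul_assoc[symmetric] assms by simp
  finally show ?thesis ..
qed

lemma matrix_inv_diag_cis: "matrix_inv (diag_cis \<theta>) = diag_cis (\<lambda>j. - \<theta> j)"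
proof (rule matrix_inv_eq_right_inverse)
  have "(diag_cis \<theta> ** diag_cis (\<lambda>j. - \<theta> j)) *v x = mat 1 *v x" for x
    unfolding matrix_vector_mul_assoc[symmetric] vec_eq_iff diag_cis_mult_vec
    by (simp add: cis_mult flip: mult.assoc)
  then show "diag_cis \<theta> ** diag_cis (\<lambda>j. - \<theta> j) = mat 1"
    by (simp add: matrix_eq)
qed

text \<open>Reverse triangle inequality with one term singled out; applied to \<open>c\<close>,
  whose terms have norms \<open>p j\<close> with sum \<open>1\<close>, it will give
  \<open>2 * p m - 1 \<le> cmod c\<close>.\<close>

lemma norm_sum_ge_dominant:
  fixes f :: "'n :: finite \<Rightarrow> 'a :: real_normed_vector"
  shows "2 * norm (f m) - (\<Sum>j\<in>UNIV. norm (f j)) \<le> norm (\<Sum>j\<in>UNIV. f j)"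
proof -
  have "norm (f m) - norm (\<Sum>j\<in>UNIV - {m}. f j) \<le> norm (f m + (\<Sum>j\<in>UNIV - {m}. f j))"
    by (rule norm_diff_ineq)
  moreover have "norm (\<Sum>j\<in>UNIV - {m}. f j) \<le> (\<Sum>j\<in>UNIV - {m}. norm (f j))"
    by (rule norm_sum)
  moreover have "norm (\<Sum>j\<in>UNIV. f j) = norm (f m + (\<Sum>j\<in>UNIV - {m}. f j))"
    by (rule arg_cong[OF sum.remove]) auto
  moreover have "(\<Sum>j\<in>UNIV. norm (f j)) = norm (f m) + (\<Sum>j\<in>UNIV - {m}. norm (f j))"
    by (rule sum.remove) auto
  ultimately show ?thesis by linarith
qed

text \<open>The unimodular factor \<open>u\<close> turns both off-diagonal entries into
  \<open>- cmod c\<close>, so real weights suffice; the diagonal entries are conjugate to each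
  other, whence the factor \<open>a^2 - b^2\<close> at \<open>r\<close>.\<close>

lemma cform_plane:
  assumes yy: "cform (complexify A) y y = Complex q r"
    and c: "cform (complexify A) (vec_cnj y) y = c"
    and u: "cmod u = 1" "u * cnj c = - complex_of_real (cmod c)"
  shows "cform (complexify A)
      (of_real a *s y + (of_real b * u) *s vec_cnj y) (of_real a *s y + (of_real b * u) *s vec_cnj y)
    = Complex ((a\<^sup>2 + b\<^sup>2) * q - 2 * a * b * cmod c) ((a\<^sup>2 - b\<^sup>2) * r)"
proof -
  have uu: "cnj u * u = 1" using u(1) complex_norm_square[of u] by (simp add: mult.commute)
  have cu: "cnj u * c = - complex_of_real (cmod c)"
    using arg_cong[OF u(2), of cnj] by simp
  have yy': "cform (complexify A) (vec_cnj y) (vec_cnj y) = cnj (Complex q r)"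
    by (simp only: cform_vec_cnj yy)
  have c': "cform (complexify A) y (vec_cnj y) = cnj c"
    using cform_vec_cnj[of A "vec_cnj y" y] c by simp
  have "cform (complexify A)
      (of_real a *s y + (of_real b * u) *s vec_cnj y) (of_real a *s y + (of_real b * u) *s vec_cnj y)
    = of_real (a\<^sup>2) * Complex q r + of_real (b\<^sup>2) * (cnj u * u) * cnj (Complex q r)
      + of_real (a * b) * (u * cnj c) + of_real (a * b) * (cnj u * c)"
    by (simp add: cform_add_left cform_add_right cform_scale_left cform_scale_right yy yy' c c'
        power2_eq_square algebra_simps)
  also have "\<dots> = Complex ((a\<^sup>2 + b\<^sup>2) * q - 2 * a * b * cmod c) ((a\<^sup>2 - b\<^sup>2) * r)"
    unfolding u uu cu by (simp add: complex_eq_iff algebra_simps)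
  finally show ?thesis .
qed

text \<open>
  The weights \<open>q \<plusminus> s\<close> with \<open>s\<^sup>2 = q\<^sup>2 - C\<^sup>2\<close> maximize the angle of the compression of the
  form to the plane spanned by \<open>y\<close> and its conjugate.
\<close>

lemma plane_angle_bound:
  fixes q r t C :: real
  assumes bound: "\<And>a b. (a\<^sup>2 - b\<^sup>2) * r \<le> t * ((a\<^sup>2 + b\<^sup>2) * q - 2 * a * b * C)"
    and "0 \<le> C" "C < q"
  shows "\<bar>r\<bar> / sqrt (q\<^sup>2 - C\<^sup>2) \<le> t"
proof -
  define s where "s = sqrt (q\<^sup>2 - C\<^sup>2)"
  have "C\<^sup>2 < q\<^sup>2" using assms by (intro power_strict_mono) auto
  then have s: "s > 0" "s\<^sup>2 = q\<^sup>2 - C\<^sup>2" by (simp_all add: s_def)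
  then have "s \<le> q" using assms by (intro power2_le_imp_le[of s q]) auto
  define a b where "a = sqrt (q + s)" and "b = sqrt (q - s)"
  have ab: "a\<^sup>2 = q + s" "b\<^sup>2 = q - s" using s(1) \<open>s \<le> q\<close> by (simp_all add: a_def b_def)
  have "(q + s) * (q - s) = C\<^sup>2"
    using s(2) by (simp add: power2_eq_square algebra_simps)
  then have "a * b = sqrt (C\<^sup>2)"
    unfolding a_def b_def real_sqrt_mult[symmetric] by (rule arg_cong)
  then have prod: "a * b = C" using \<open>0 \<le> C\<close> by simp
  have den: "(a\<^sup>2 + b\<^sup>2) * q - 2 * a * b * C = 2 * s * s"
  proof -
    have "(a\<^sup>2 + b\<^sup>2) * q - 2 * a * b * C = (q + s + (q - s)) * q - 2 * (a * b) * C"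
      by (simp only: ab mult.assoc)
    also have "\<dots> = 2 * (q\<^sup>2 - C\<^sup>2)"
      unfolding prod by (simp add: power2_eq_square algebra_simps)
    also have "\<dots> = 2 * s * s"
      unfolding s(2)[symmetric] by (simp add: power2_eq_square)
    finally show ?thesis .
  qed
  \<comment> \<open>Exchanging the weights keeps the real part and flips the sign of the imaginary
    part, which yields the bound for both \<open>r\<close> and \<open>- r\<close>.\<close>
  have num: "(a\<^sup>2 - b\<^sup>2) * r = 2 * s * r" "(b\<^sup>2 - a\<^sup>2) * r = 2 * s * (- r)"
    by (simp_all add: ab)
  have "(b\<^sup>2 + a\<^sup>2) * q - 2 * b * a * C = (a\<^sup>2 + b\<^sup>2) * q - 2 * a * b * C"
    by (simp add: algebra_simps)
  then have swap: "(b\<^sup>2 + a\<^sup>2) * q - 2 * b * a * C = 2 * s * s"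
    unfolding den .
  have ts: "t * (2 * s * s) = 2 * s * (t * s)" by simp
  have "2 * s > 0" using s(1) by simp
  then have "r \<le> t * s" "- r \<le> t * s"
    using bound[of a b] bound[of b a]
    unfolding den swap num ts by (blast dest: mult_left_le_imp_le)+
  then have "\<bar>r\<bar> \<le> t * s" by simp
  then show ?thesis using s(1) by (simp add: s_def[symmetric] pos_divide_le_eq)
qed

section \<open>The lower bound for the largest phase\<close>

theorem proposition4p7:
  fixes \<mu> :: "'n :: {finite, linorder} \<Rightarrow> real"
    and M :: "(complex, 'n) sq_matrix"
    and \<Delta> :: "(real, 'n) sq_matrix"
    and z :: "(complex, 'n) vec"
    and p :: "'n \<Rightarrow> real"
    and q r \<rho> :: real
  assumes M_def: "M = diag_cis \<mu>"
    and \<mu>_order: "antimono \<mu>"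
    and \<mu>_upper: "\<mu> first_index < pi"
    and \<mu>_lower: "\<mu> last_index > - pi / 2"
    and \<mu>_spread: "\<mu> first_index - \<mu> last_index < pi"
    and \<Delta>_pd: "positive_definite (\<Delta> + transpose \<Delta>)"
    and singular: "det (mat 1 + M ** complexify \<Delta>) = 0"
    and z_nonzero: "z \<noteq> 0"
    and z_eq: "complexify \<Delta> *v z = - (matrix_inv M *v z)"
    and p_def: "p = (\<lambda>j. (cmod (z $ j))\<^sup>2 / (norm z)\<^sup>2)"
    and q_def: "q = - (\<Sum>j\<in>UNIV. p j * cos (\<mu> j))"
    and r_def: "r = (\<Sum>j\<in>UNIV. p j * sin (\<mu> j))"
    and \<rho>_def: "\<rho> = max 0 (2 * Max (range p) - 1)"
  shows "q > \<rho> \<and> phases \<Delta> first_index \<ge> arctan (\<bar>r\<bar> / sqrt (q\<^sup>2 - \<rho>\<^sup>2))"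
proof -
  let ?D = "complexify \<Delta>"
  define y where "y = complex_of_real (inverse (norm z)) *s z"
  have y_nonzero: "y \<noteq> 0" using z_nonzero by (auto simp: y_def vec_eq_iff)
  have p: "p j = (cmod (y $ j))\<^sup>2" for j
    by (simp add: p_def y_def norm_mult power_mult_distrib divide_inverse norm_inverse
        power_inverse mult.commute)
  have "norm y = 1"
    unfolding y_def complex_scalar_mult_of_real using z_nonzero by simp
  then have p_sum: "(\<Sum>j\<in>UNIV. p j) = 1"
    by (simp add: p norm_vec_def L2_set_def)
  have "?D *v y = - (diag_cis (\<lambda>j. - \<mu> j) *v y)"
    by (simp add: y_def vector_scalar_commute z_eq M_def matrix_inv_diag_cis vec_eq_iff)
  then have Dy: "(?D *v y) $ j = - cis (- \<mu> j) * y $ j" for j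
    by (simp add: diag_cis_mult_vec)
  have "cform ?D y y = (\<Sum>j\<in>UNIV. - (of_real (p j) * cis (- \<mu> j)))"
    unfolding cform_def Dy p complex_norm_square by (simp add: mult_ac)
  then have yy: "cform ?D y y = Complex q r"
    by (simp add: complex_eq_iff q_def r_def sum_negf)
  have q_pos: "q > 0" using Re_cform_pos[OF \<Delta>_pd y_nonzero] by (simp add: yy)
  define c where "c = cform ?D (vec_cnj y) y"
  have c: "c = (\<Sum>j\<in>UNIV. - (cis (- \<mu> j) * (y $ j)\<^sup>2))"
    unfolding c_def cform_def Dy by (simp add: vec_cnj_def power2_eq_square mult_ac)
  have "2 * p m - 1 \<le> cmod c" for m
    using norm_sum_ge_dominant[of "\<lambda>j. - (cis (- \<mu> j) * (y $ j)\<^sup>2)" m] p_sum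
    unfolding c by (simp add: norm_mult norm_power p)
  moreover have "Max (range p) \<in> range p" by (rule Max_in) auto
  ultimately have "2 * Max (range p) - 1 \<le> cmod c" by (metis rangeE)
  then have \<rho>_le: "\<rho> \<le> cmod c" by (simp add: \<rho>_def)
  \<comment> \<open>Cancels the argument of \<open>c\<close> up to sign. For \<open>c = 0\<close>
    the convention \<open>Arg 0 = 0\<close> gives \<open>u = - 1\<close>, and both required
    properties still hold.\<close>
  define u where "u = - cis (Arg c)"
  have u: "cmod u = 1" "u * cnj c = - complex_of_real (cmod c)"
  proof -
    show "cmod u = 1" by (simp add: u_def)
    have "cnj c = of_real (cmod c) * cis (- Arg c)"
      by (metis cis_cnj complex_cnj_complex_of_real complex_cnj_mult rcis_cmod_Arg rcis_def)
    then show "u * cnj c = - complex_of_real (cmod c)"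
      by (simp add: u_def cis_mult)
  qed
  note plane = cform_plane[OF yy c_def[symmetric] u]
  \<comment> \<open>Needed for strict positivity of the form at this vector. Were it zero,
    \<open>y\<close> would be a multiple of its conjugate, and realness of \<open>\<Delta>\<close>
    would force \<open>\<mu> j = 0\<close> wherever \<open>y $ j\<close> is nonzero; then
    \<open>q = - 1\<close>, against \<open>q > 0\<close>.\<close>
  have "y + u *s vec_cnj y \<noteq> 0"
  proof
    assume "y + u *s vec_cnj y = 0"
    have y_eq: "y = (- u) *s vec_cnj y"
      using \<open>y + u *s vec_cnj y = 0\<close> by (simp add: add_eq_0_iff2)
    have "p j * cos (\<mu> j) = p j" for j
    proof (cases "y $ j = 0")
      case False
      have "?D *v y = ?D *v ((- u) *s vec_cnj y)" using y_eq by (rule arg_cong)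
      also have "\<dots> = (- u) *s vec_cnj (?D *v y)"
        by (simp only: vector_scalar_commute complexify_mult_vec_cnj)
      finally have "(?D *v y) $ j = (- u) * cnj ((?D *v y) $ j)"
        unfolding vec_eq_iff vector_smult_component by (simp add: vec_cnj_def)
      then have "- cis (- \<mu> j) * y $ j = (- u) * (- cis (\<mu> j) * cnj (y $ j))"
        unfolding Dy by (simp add: cis_cnj)
      also have "\<dots> = - cis (\<mu> j) * ((- u) * cnj (y $ j))" by simp
      also have "(- u) * cnj (y $ j) = y $ j"
        using arg_cong[OF y_eq, of "\<lambda>v. v $ j"] by (simp add: vec_cnj_def)
      finally have "cis (- \<mu> j) = cis (\<mu> j)" using False by simp
      then have "sin (\<mu> j) = 0" by (simp add: complex_eq_iff)
      \<comment> \<open>Every \<open>\<mu> j\<close> lies strictly between \<open>- pi\<close> and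
        \<open>pi\<close>, where the sine vanishes only at \<open>0\<close>.\<close>
      moreover have "\<mu> j \<le> \<mu> first_index" "\<mu> last_index \<le> \<mu> j"
        using \<mu>_order by (simp_all add: antimonoD first_index_def last_index_def)
      then have "- pi < \<mu> j" "\<mu> j < pi" using \<mu>_upper \<mu>_lower by auto
      ultimately have "\<mu> j = 0" by (simp add: sin_eq_0_pi)
      then show ?thesis by simp
    qed (simp add: p)
    then have "q = - 1" using p_sum by (simp only: q_def)
    then show False using q_pos by simp
  qed
  \<comment> \<open>For \<open>a = b = 1\<close> the plane formula has real part
    \<open>2 * (q - cmod c)\<close>.\<close>
  then have q_gt: "cmod c < q"
    using plane[of 1 1] Re_cform_pos[OF \<Delta>_pd, of "y + u *s vec_cnj y"] by simp
  define \<phi> where "\<phi> = phases \<Delta>"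
  have is_phases: "is_phases \<Delta> \<phi>"
    unfolding \<phi>_def by (rule is_phases_phases[OF \<Delta>_pd])
  have "(a\<^sup>2 - b\<^sup>2) * r \<le> tan (\<phi> first_index) * ((a\<^sup>2 + b\<^sup>2) * q - 2 * a * b * cmod c)" for a b
    using numerical_range_angle_le[OF is_phases,
        of "of_real a *s y + (of_real b * u) *s vec_cnj y"]
    unfolding plane by simp
  then have "\<bar>r\<bar> / sqrt (q\<^sup>2 - (cmod c)\<^sup>2) \<le> tan (\<phi> first_index)"
    by (rule plane_angle_bound) (simp_all add: q_gt)
  \<comment> \<open>Replacing \<open>cmod c\<close> by its lower bound \<open>\<rho>\<close> can
    only enlarge the denominator; the result depends on \<open>p\<close>, \<open>q\<close> and
    \<open>r\<close> alone.\<close>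
  moreover have "\<bar>r\<bar> / sqrt (q\<^sup>2 - \<rho>\<^sup>2) \<le> \<bar>r\<bar> / sqrt (q\<^sup>2 - (cmod c)\<^sup>2)"
  proof (rule divide_left_mono)
    have "\<rho> \<ge> 0" by (simp add: \<rho>_def)
    then show "sqrt (q\<^sup>2 - (cmod c)\<^sup>2) \<le> sqrt (q\<^sup>2 - \<rho>\<^sup>2)"
      using \<rho>_le by (simp add: power_mono)
    have "(cmod c)\<^sup>2 < q\<^sup>2" using q_gt by (intro power_strict_mono) auto
    moreover have "\<rho>\<^sup>2 < q\<^sup>2" using q_gt \<rho>_le \<open>\<rho> \<ge> 0\<close> by (intro power_strict_mono) auto
    ultimately show "0 < sqrt (q\<^sup>2 - \<rho>\<^sup>2) * sqrt (q\<^sup>2 - (cmod c)\<^sup>2)" by simp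
  qed simp
  ultimately have "arctan (\<bar>r\<bar> / sqrt (q\<^sup>2 - \<rho>\<^sup>2)) \<le> arctan (tan (\<phi> first_index))"
    by (simp add: arctan_le_iff)
  also have "\<dots> = \<phi> first_index"
    using is_phases by (intro arctan_tan) (auto simp: is_phases_def)
  finally show ?thesis using q_gt \<rho>_le by (simp add: \<phi>_def)
qed

end
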